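(* (a) If $p\in[\sqrt{10}/5,1]$ and $q\in(0,1/2]$, then for all $t\in(0,\pi/2)$ $$(\cos pt)^{2/(3p^2)}<e^{t\cot t-1}<(\cos qt)^{2/(3q^2)}.$$ (b) In particular, for all $t\in(0,\pi/2)$, $$\left(\cos\tfrac{2t}{3}\right)^{3/2}<e^{t\cot t-1}<\left(\cos\tfrac t2\right)^{8/3}<\left(\cos\tfrac t3\right)^{6}<e^{-t^2/3}.$$ (c) For all $t\in(0,\pi/2)$, $$\left(\cos\tfrac t2\right)^{2/\ln 2}<e^{t\cot t-1}<\left(\cos\tfrac t2\right)^{8/3},$$ and the exponents $2/\ln 2$ and $8/3$ are best possible: if $\left(\cos\frac t2\right)^{r}<e^{t\cot t-1}$ for all $t\in(0,\pi/2)$ then $r\ge 2/\ln 2$, and if $e^{t\cot t-1}<\left(\cos\frac t2\right)^{s}$ for all $t\in(0,\pi/2)$ then $s\le 8/3$. *)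

theory Defs
  imports Complex_Main
begin

end

theory Submission
  imports Defs "HOL-Real_Asymp.Real_Asymp"
begin

text \<open>
  Taking logarithms, everything is a comparison of \<open>1 - t cot t\<close> with multiples of
  \<open>- ln (cos (p t))\<close>. The monotone form of l'Hospital's rule shows that \<open>- ln (cos x) / x\<^sup>2\<close>
  increases from \<open>1/2\<close>, which reduces (a) to the extreme values of \<open>p\<close> and \<open>q\<close> and gives the
  outer inequalities of (b). The same rule shows that \<open>(1 - t cot t) / (- ln (cos (t / 2)))\<close> increases on
  \<open>(0, 2\<pi>/3)\<close>; its limit \<open>8/3\<close> at \<open>0\<close> and its value \<open>2 / ln 2\<close> at \<open>\<pi>/2\<close> give (c) and
  the case \<open>q = 1/2\<close>. For \<open>p\<^sup>2 = 2/5\<close> the derivative \<open>g\<close> of \<open>1 - t cot t\<close> is a strict subsolution of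
  the Riccati equation \<open>y' = 2/3 + 3/5 y\<^sup>2\<close>, whose solution \<open>2/(3p) tan (p t)\<close> is the derivative of
  \<open>- 2/(3p\<^sup>2) ln (cos (p t))\<close>.
\<close>

section \<open>Monotonicity tools and the monotone form of l'Hospital's rule\<close>

lemma strict_mono_on_gt_right_limit:
  fixes f :: "real \<Rightarrow> real"
  assumes lim: "(f \<longlongrightarrow> L) (at_right a)" and mono: "strict_mono_on {a<..<b} f"
    and x: "a < x" "x < b"
  shows "L < f x"
proof -
  \<comment> \<open>The limit alone would give only a weak bound; the intermediate point
    \<open>m\<close> makes it strict.\<close>
  define m where "m = (a + x) / 2"
  have m: "a < m" "m < x" using x by (auto simp: m_def)
  have "eventually (\<lambda>u. f u \<le> f m) (at_right a)"
    using eventually_at_right_real[OF m(1)]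
  proof eventually_elim
    case (elim u)
    then show ?case
      using strict_mono_onD[OF mono, of u m] m x by auto
  qed
  then have "L \<le> f m"
    using lim by (intro tendsto_upperbound[of f L]) auto
  also have "\<dots> < f x"
    using strict_mono_onD[OF mono, of m x] m x by auto
  finally show ?thesis .
qed

lemma deriv_pos_imp_strict_mono_on:
  fixes f f' :: "real \<Rightarrow> real"
  assumes "\<And>x. a < x \<Longrightarrow> x < b \<Longrightarrow> (f has_real_derivative f' x) (at x)"
    and "\<And>x. a < x \<Longrightarrow> x < b \<Longrightarrow> f' x > 0"
  shows "strict_mono_on {a<..<b} f"
proof (rule strict_mono_onI)
  fix x y assume "x \<in> {a<..<b}" "y \<in> {a<..<b}" "x < y"
  then show "f x < f y"
    using assms by (intro DERIV_pos_imp_increasing[of x y f]) force+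
qed

text \<open>A one-sided limit at \<open>a\<close> replaces continuity there because several
  functions below have a removable singularity: at \<open>t = 0\<close> the term
  \<open>1 - t * cot t\<close> evaluates to 1, while its limit is 0.\<close>

lemma deriv_pos_imp_pos:
  fixes f f' :: "real \<Rightarrow> real"
  assumes "(f \<longlongrightarrow> 0) (at_right a)"
    and "\<And>x. a < x \<Longrightarrow> x < b \<Longrightarrow> (f has_real_derivative f' x) (at x)"
    and "\<And>x. a < x \<Longrightarrow> x < b \<Longrightarrow> f' x > 0"
    and "a < x" "x < b"
  shows "f x > 0"
  using strict_mono_on_gt_right_limit[OF assms(1) deriv_pos_imp_strict_mono_on[OF assms(2,3)]] assms(4,5)
  by blast

text \<open>Let \<open>r\<close> be the quotient of the derivatives at \<open>x\<close>. Before
  \<open>x\<close> that quotient is below \<open>r\<close>, so \<open>f x / g x\<close> is at most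
  \<open>r\<close>; after \<open>x\<close> it is above \<open>r\<close>, so from \<open>x\<close> to
  \<open>y\<close> the increment of \<open>f\<close> exceeds \<open>r\<close> times that of
  \<open>g\<close>.\<close>

lemma lhospital_strict_mono_on:
  fixes f g f' g' :: "real \<Rightarrow> real"
  assumes f: "(f \<longlongrightarrow> 0) (at_right a)" and g: "(g \<longlongrightarrow> 0) (at_right a)"
    and f': "\<And>x. a < x \<Longrightarrow> x < b \<Longrightarrow> (f has_real_derivative f' x) (at x)"
    and g': "\<And>x. a < x \<Longrightarrow> x < b \<Longrightarrow> (g has_real_derivative g' x) (at x)"
    and g'_pos: "\<And>x. a < x \<Longrightarrow> x < b \<Longrightarrow> g' x > 0"
    and mono: "strict_mono_on {a<..<b} (\<lambda>x. f' x / g' x)"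
  shows "strict_mono_on {a<..<b} (\<lambda>x. f x / g x)"
proof (rule strict_mono_onI)
  fix x y assume xy: "x \<in> {a<..<b}" "y \<in> {a<..<b}" "x < y"
  define r where "r = f' x / g' x"
  have g_pos: "g u > 0" if "a < u" "u < b" for u
    using deriv_pos_imp_pos[OF g g' g'_pos that] .
  have g_less: "g x < g y"
    using strict_mono_onD[OF deriv_pos_imp_strict_mono_on[OF g' g'_pos], of a b x y] xy by auto
  have "r * g u - f u > 0" if u: "a < u" "u < x" for u
  proof (rule deriv_pos_imp_pos[OF _ _ _ u])
    show "((\<lambda>u. r * g u - f u) \<longlongrightarrow> 0) (at_right a)"
      using f g by (auto intro!: tendsto_eq_intros)
  next
    fix v assume v: "a < v" "v < x"
    then show "((\<lambda>u. r * g u - f u) has_real_derivative r * g' v - f' v) (at v)"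
      using xy by (auto intro!: derivative_eq_intros f' g')
    have "f' v / g' v < r"
      using strict_mono_onD[OF mono, of v x] v xy by (auto simp: r_def)
    then show "r * g' v - f' v > 0"
      using g'_pos[of v] v xy by (auto simp: field_simps)
  qed
  \<comment> \<open>A left limit carries the inequality to \<open>x\<close> itself. The weak form
    suffices, since the interval from \<open>x\<close> to \<open>y\<close> supplies
    strictness.\<close>
  then have "eventually (\<lambda>u. f u \<le> r * g u) (at_left x)"
    using eventually_at_left_real[of a x] xy by (auto elim!: eventually_mono simp: less_imp_le)
  moreover have "((\<lambda>u. f u) \<longlongrightarrow> f x) (at_left x)" "((\<lambda>u. r * g u) \<longlongrightarrow> r * g x) (at_left x)"
    using f'[of x] g'[of x] xy
    by (auto intro!: tendsto_mult dest!: DERIV_isCont simp: isCont_def intro: tendsto_within_subset)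
  ultimately have "f x \<le> r * g x"
    by (intro tendsto_le[of "at_left x" "\<lambda>u. r * g u" _ f]) auto
  moreover have "f x - r * g x < f y - r * g y"
  proof (rule DERIV_pos_imp_increasing_open[OF \<open>x < y\<close>])
    fix v assume v: "x < v" "v < y"
    have "r < f' v / g' v"
      using strict_mono_onD[OF mono, of x v] v xy by (auto simp: r_def)
    then have "f' v - r * g' v > 0"
      using g'_pos[of v] v xy by (auto simp: field_simps)
    moreover have "((\<lambda>u. f u - r * g u) has_real_derivative f' v - r * g' v) (at v)"
      using v xy by (auto intro!: derivative_eq_intros f' g')
    ultimately show "\<exists>D. ((\<lambda>u. f u - r * g u) has_real_derivative D) (at v) \<and> D > 0"
      by blast
  next
    show "continuous_on {x..y} (\<lambda>u. f u - r * g u)"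
    proof (intro continuous_at_imp_continuous_on ballI)
      fix v assume "v \<in> {x..y}"
      then have "((\<lambda>u. f u - r * g u) has_real_derivative f' v - r * g' v) (at v)"
        using xy by (auto intro!: derivative_eq_intros f' g')
      then show "isCont (\<lambda>u. f u - r * g u) v" by (rule DERIV_isCont)
    qed
  qed
  ultimately have r: "f x / g x \<le> r" "f x + r * (g y - g x) < f y"
    using g_pos[of x] xy by (auto simp: field_simps)
  have "f x / g x * g y = f x + f x / g x * (g y - g x)"
    using g_pos[of x] xy by (auto simp: field_simps)
  also have "\<dots> \<le> f x + r * (g y - g x)"
    using r(1) g_less by (intro add_left_mono mult_right_mono) auto
  also have "\<dots> < f y" by (fact r(2))
  finally show "f x / g x < f y / g y"
    using g_pos[of y] xy by (simp add: pos_less_divide_eq)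
qed

section \<open>Growth of - ln (cos x) / x^2 and dependence on the parameter p\<close>

lemma tan_div_strict_mono_on: "strict_mono_on {0<..<pi/2} (\<lambda>x. tan x / x :: real)"
proof (rule lhospital_strict_mono_on)
  show "(tan \<longlongrightarrow> (0::real)) (at_right 0)" by real_asymp
  show "((\<lambda>x. x) \<longlongrightarrow> (0::real)) (at_right 0)" by real_asymp
next
  fix x :: real assume x: "0 < x" "x < pi/2"
  then show "(tan has_real_derivative inverse ((cos x)\<^sup>2)) (at x)"
    using cos_gt_zero[of x] by (intro DERIV_tan) auto
  show "((\<lambda>x. x) has_real_derivative 1) (at x)" by (rule DERIV_ident)
next
  show "strict_mono_on {0<..<pi/2} (\<lambda>x. inverse ((cos x)\<^sup>2) / (1::real))"
  proof (rule strict_mono_onI)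
    fix x y :: real assume "x \<in> {0<..<pi/2}" "y \<in> {0<..<pi/2}" "x < y"
    then have "0 < cos y" "cos y < cos x"
      by (auto intro!: cos_gt_zero cos_monotone_0_pi)
    then have "(cos y)\<^sup>2 < (cos x)\<^sup>2" "0 < (cos y)\<^sup>2" by (auto intro!: power_strict_mono)
    then show "inverse ((cos x)\<^sup>2) / 1 < inverse ((cos y)\<^sup>2) / 1"
      by (simp add: less_imp_inverse_less)
  qed
qed simp_all

lemma ln_cos_div_square_strict_mono_on:
  "strict_mono_on {0<..<pi/2} (\<lambda>x. - ln (cos x) / x\<^sup>2 :: real)"
proof (rule lhospital_strict_mono_on)
  show "((\<lambda>x. - ln (cos x)) \<longlongrightarrow> (0::real)) (at_right 0)" by real_asymp
  show "((\<lambda>x. x\<^sup>2) \<longlongrightarrow> (0::real)) (at_right 0)" by real_asymp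
next
  fix x :: real assume x: "0 < x" "x < pi/2"
  then show "((\<lambda>x. - ln (cos x)) has_real_derivative tan x) (at x)"
    using cos_gt_zero[of x] by (auto intro!: derivative_eq_intros simp: tan_def field_simps)
  show "((\<lambda>x. x\<^sup>2) has_real_derivative 2 * x) (at x)"
    by (auto intro!: derivative_eq_intros)
  show "0 < 2 * x" using x by simp
next
  show "strict_mono_on {0<..<pi/2} (\<lambda>x. tan x / (2 * x) :: real)"
    using tan_div_strict_mono_on by (simp add: strict_mono_on_def field_simps)
qed

lemma ln_cos_less: "ln (cos x) < - (x\<^sup>2 / 2)" if "0 < x" "x < pi/2" for x :: real
proof -
  have "((\<lambda>x. - ln (cos x) / x\<^sup>2) \<longlongrightarrow> (1/2::real)) (at_right 0)" by real_asymp
  from strict_mono_on_gt_right_limit[OF this ln_cos_div_square_strict_mono_on that]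
  show ?thesis using that by (simp add: field_simps)
qed

lemma ln_cos_neg: "ln (cos x) < 0" if "0 < x" "x < pi/2" for x :: real
  using ln_cos_less[OF that] zero_le_power2[of x] by linarith

text \<open>The logarithms of the two sides are -2 t^2 / 3 times the values of
  \<open>- ln (cos x) / x\<^sup>2\<close> at \<open>q * t\<close> and \<open>p * t\<close>, and this
  quotient is increasing.\<close>

lemma cos_powr_antimono:
  fixes p q t :: real
  assumes "0 < p" "p < q" "0 < t" "q * t < pi/2"
  shows "cos (q * t) powr (2 / (3 * q\<^sup>2)) < cos (p * t) powr (2 / (3 * p\<^sup>2))"
proof -
  have pt: "0 < p * t" "p * t < q * t" using assms by simp_all
  then have pt': "p * t < pi/2" "0 < q * t" using assms by linarith+
  have "- ln (cos (p * t)) / (p * t)\<^sup>2 < - ln (cos (q * t)) / (q * t)\<^sup>2"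
    using strict_mono_onD[OF ln_cos_div_square_strict_mono_on, of "p * t" "q * t"] pt pt' assms by auto
  then have "ln (cos (q * t)) / q\<^sup>2 < ln (cos (p * t)) / p\<^sup>2"
    using assms by (simp add: power_mult_distrib field_simps)
  then have "2 / (3 * q\<^sup>2) * ln (cos (q * t)) < 2 / (3 * p\<^sup>2) * ln (cos (p * t))"
    by simp
  moreover have "cos (p * t) > 0" "cos (q * t) > 0" using assms pt pt' by (simp_all only: cos_gt_zero)
  ultimately show ?thesis by (simp add: powr_def)
qed

section \<open>The function 1 - t cot t and its ratio to - ln (cos (t / 2))\<close>

lemma sin_mult_cos_less: "sin t * cos t < t" if "0 < t" "t < pi" for t :: real
proof -
  have "0 < t - sin t * cos t"
  proof (rule deriv_pos_imp_pos[OF _ _ _ that])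
    show "((\<lambda>t. t - sin t * cos t) \<longlongrightarrow> (0::real)) (at_right 0)" by real_asymp
  next
    fix x :: real assume x: "0 < x" "x < pi"
    show "((\<lambda>t. t - sin t * cos t) has_real_derivative 2 * (sin x)\<^sup>2) (at x)"
      using sin_cos_squared_add[of x]
      by (auto intro!: derivative_eq_intros simp: power2_eq_square)
    show "0 < 2 * (sin x)\<^sup>2" using sin_gt_zero[OF x] by simp
  qed
  then show ?thesis by simp
qed

lemma has_real_derivative_one_minus_mult_cot:
  "((\<lambda>t. 1 - t * cot t) has_real_derivative (t - sin t * cos t) / (sin t)\<^sup>2) (at t)"
  if "sin t \<noteq> 0" for t :: real
  using that
  by (auto intro!: derivative_eq_intros DERIV_cot simp: cot_def field_simps power2_eq_square,
      use sin_cos_squared_add[of t] in algebra)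

text \<open>Two applications of the monotone l'Hospital rule lead, up to a factor 2, to 2 (1 + cos
  x) / (1 + 2 cos x) = 1 + 1 / (1 + 2 cos x), which grows as cos x decreases. The bound
  \<open>2*pi/3\<close> is where 1 + 2 cos x vanishes.\<close>

lemma one_minus_mult_cot_div_strict_mono_on:
  "strict_mono_on {0<..<2*pi/3} (\<lambda>t. (1 - t * cot t) / (- ln (cos (t / 2))) :: real)"
proof (rule lhospital_strict_mono_on)
  show "((\<lambda>t. 1 - t * cot t) \<longlongrightarrow> (0::real)) (at_right 0)" unfolding cot_def by real_asymp
  show "((\<lambda>t. - ln (cos (t / 2))) \<longlongrightarrow> (0::real)) (at_right 0)" by real_asymp
next
  fix x :: real assume x: "0 < x" "x < 2*pi/3"
  have s: "sin x > 0" and c: "cos (x/2) > 0" and s2: "sin (x/2) > 0"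
    using x pi_gt_zero by (auto intro!: sin_gt_zero cos_gt_zero)
  show "((\<lambda>t. 1 - t * cot t) has_real_derivative (x - sin x * cos x) / (sin x)\<^sup>2) (at x)"
    using s by (intro has_real_derivative_one_minus_mult_cot) simp
  \<comment> \<open>The derivative tan (x/2) / 2 is rewritten over \<open>(sin x)\<^sup>2\<close>,
    so that this factor cancels in the quotient of derivatives and the rule applies again.\<close>
  have "(sin x - sin x * cos x) / (2 * (sin x)\<^sup>2) = (1 - cos x) / (2 * sin x)"
    using s by (simp add: field_simps power2_eq_square)
  moreover have half: "sin x = 2 * sin (x/2) * cos (x/2)" "cos x = 1 - 2 * (sin (x/2))\<^sup>2"
    using sin_double[of "x/2"] cos_double_sin[of "x/2"] by simp_all
  have "(1 - cos x) / (2 * sin x) = tan (x/2) / 2"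
    unfolding half using c s2 by (simp add: tan_def field_simps power2_eq_square)
  ultimately have "(sin x - sin x * cos x) / (2 * (sin x)\<^sup>2) = tan (x/2) / 2" by simp
  then show "((\<lambda>t. - ln (cos (t / 2))) has_real_derivative
        (sin x - sin x * cos x) / (2 * (sin x)\<^sup>2)) (at x)"
    using c by (auto intro!: derivative_eq_intros simp: tan_def field_simps)
  have "cos x < 1" using cos_monotone_0_pi[of 0 x] x pi_gt_zero by simp
  then show "0 < (sin x - sin x * cos x) / (2 * (sin x)\<^sup>2)"
    using s by (simp add: field_simps)
next
  have mono: "strict_mono_on {0<..<2*pi/3} (\<lambda>x. (x - sin x * cos x) / (sin x - sin x * cos x))"
  proof (rule lhospital_strict_mono_on)
    show "((\<lambda>x. x - sin x * cos x) \<longlongrightarrow> (0::real)) (at_right 0)" by real_asymp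
    show "((\<lambda>x. sin x - sin x * cos x) \<longlongrightarrow> (0::real)) (at_right 0)" by real_asymp
  next
    fix x :: real assume x: "0 < x" "x < 2*pi/3"
    have c: "cos x > -1/2" "cos x < 1"
      using cos_monotone_0_pi[of x "2*pi/3"] cos_monotone_0_pi[of 0 x] x pi_gt_zero
      by (simp_all add: cos_120)
    show "((\<lambda>x. x - sin x * cos x) has_real_derivative 2 * (1 + cos x) * (1 - cos x)) (at x)"
      by (auto intro!: derivative_eq_intros, use sin_cos_squared_add[of x] in algebra)
    show "((\<lambda>x. sin x - sin x * cos x) has_real_derivative (1 + 2 * cos x) * (1 - cos x)) (at x)"
      by (auto intro!: derivative_eq_intros, use sin_cos_squared_add[of x] in algebra)
    show "0 < (1 + 2 * cos x) * (1 - cos x)" using c by simp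
  next
    show "strict_mono_on {0<..<2*pi/3}
        (\<lambda>x. 2 * (1 + cos x) * (1 - cos x) / ((1 + 2 * cos x) * (1 - cos x)) :: real)"
    proof (rule strict_mono_onI)
      fix x y :: real assume xy: "x \<in> {0<..<2*pi/3}" "y \<in> {0<..<2*pi/3}" "x < y"
      then have c: "cos y > -1/2" "cos y < cos x" "cos x < 1"
        using cos_monotone_0_pi[of y "2*pi/3"] cos_monotone_0_pi[of 0 x] cos_monotone_0_pi[of x y]
          pi_gt_zero
        by (auto simp: cos_120)
      then show "2 * (1 + cos x) * (1 - cos x) / ((1 + 2 * cos x) * (1 - cos x))
          < 2 * (1 + cos y) * (1 - cos y) / ((1 + 2 * cos y) * (1 - cos y))"
        by (simp add: divide_simps) (simp add: algebra_simps)
    qed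
  qed
  have eq: "(x - sin x * cos x) / (sin x)\<^sup>2 / ((sin x - sin x * cos x) / (2 * (sin x)\<^sup>2))
      = 2 * ((x - sin x * cos x) / (sin x - sin x * cos x))" if "x \<in> {0<..<2*pi/3}" for x :: real
    using sin_gt_zero[of x] that pi_gt_zero by simp
  show "strict_mono_on {0<..<2*pi/3} (\<lambda>x. (x - sin x * cos x) / (sin x)\<^sup>2
      / ((sin x - sin x * cos x) / (2 * (sin x)\<^sup>2)))"
    by (rule strict_mono_onI, simp only: eq)
      (intro mult_strict_left_mono strict_mono_onD[OF mono] zero_less_numeral)
qed

text \<open>Near 0 the numerator behaves like t^2 / 3 and the denominator like t^2 / 8.\<close>

lemma one_minus_mult_cot_div_tendsto:
  "((\<lambda>t. (1 - t * cot t) / (- ln (cos (t / 2)))) \<longlongrightarrow> (8/3::real)) (at_right 0)"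
  unfolding cot_def by real_asymp

lemma one_minus_mult_cot_bounds:
  fixes t :: real
  assumes t: "0 < t" "t < pi/2"
  shows "1 - t * cot t > 8/3 * (- ln (cos (t / 2)))"
    and "1 - t * cot t < 2 / ln 2 * (- ln (cos (t / 2)))"
proof -
  let ?R = "\<lambda>t. (1 - t * cot t) / (- ln (cos (t / 2))) :: real"
  have pos: "0 < - ln (cos (t / 2))"
    using ln_cos_neg[of "t/2"] t by simp
  have "8/3 < ?R t"
    using strict_mono_on_gt_right_limit[OF one_minus_mult_cot_div_tendsto
        one_minus_mult_cot_div_strict_mono_on] t by simp
  then show "1 - t * cot t > 8/3 * (- ln (cos (t / 2)))"
    using pos by (simp add: field_simps)
  \<comment> \<open>The point \<open>pi/2\<close> is interior to the interval of monotonicity, so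
    the ratio can be compared with its value there: the numerator is 1 and the denominator is ln 2 /
    2.\<close>
  have "?R t < ?R (pi/2)"
    using strict_mono_onD[OF one_minus_mult_cot_div_strict_mono_on, of t "pi/2"] t by auto
  also have "?R (pi/2) = 2 / ln 2"
    by (simp add: cot_def cos_45 ln_div ln_sqrt)
  finally show "1 - t * cot t < 2 / ln 2 * (- ln (cos (t / 2)))"
    using pos by (simp add: field_simps)
qed

section \<open>The critical parameter p^2 = 2/5 and the Riccati comparison\<close>

text \<open>With g = (t - sin t cos t) / sin^2 t, this expression is 15 sin^4 t times 2/3 + 3/5 g^2
  - g'. It is differentiated twice, the factor 16 sin is split off, and one more derivative gives 3
  sin z (z - sin z cos z); every function in the chain tends to 0 at 0.\<close>

lemma riccati_quadratic_pos:
  fixes t :: real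
  assumes t: "0 < t" "t < pi/2"
  shows "9 * t\<^sup>2 + 12 * t * sin t * cos t - 21 * (sin t * cos t)\<^sup>2 - 20 * sin t ^ 4 > 0"
proof (rule deriv_pos_imp_pos[OF _ _ _ t])
  show "((\<lambda>t. 9 * t\<^sup>2 + 12 * t * sin t * cos t - 21 * (sin t * cos t)\<^sup>2 - 20 * sin t ^ 4) \<longlongrightarrow> (0::real))
      (at_right 0)" by real_asymp
next
  fix x :: real assume x: "0 < x" "x < pi/2"
  show "((\<lambda>t. 9 * t\<^sup>2 + 12 * t * sin t * cos t - 21 * (sin t * cos t)\<^sup>2 - 20 * sin t ^ 4)
      has_real_derivative 6 * x - 26 * sin x * cos x + 24 * x * (cos x)\<^sup>2 - 4 * sin x * cos x ^ 3) (at x)"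
    by (auto intro!: derivative_eq_intros, use sin_cos_squared_add[of x] in algebra)
  show "6 * x - 26 * sin x * cos x + 24 * x * (cos x)\<^sup>2 - 4 * sin x * cos x ^ 3 > 0"
  proof (rule deriv_pos_imp_pos[OF _ _ _ x])
    show "((\<lambda>x. 6 * x - 26 * sin x * cos x + 24 * x * (cos x)\<^sup>2 - 4 * sin x * cos x ^ 3)
        \<longlongrightarrow> (0::real)) (at_right 0)" by real_asymp
  next
    fix y :: real assume y: "0 < y" "y < pi/2"
    show "((\<lambda>x. 6 * x - 26 * sin x * cos x + 24 * x * (cos x)\<^sup>2 - 4 * sin x * cos x ^ 3)
        has_real_derivative 16 * sin y * (2 * sin y + sin y * (cos y)\<^sup>2 - 3 * y * cos y)) (at y)"
      by (auto intro!: derivative_eq_intros, use sin_cos_squared_add[of y] in algebra)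
    have "2 * sin y + sin y * (cos y)\<^sup>2 - 3 * y * cos y > 0"
    proof (rule deriv_pos_imp_pos[OF _ _ _ y])
      show "((\<lambda>y. 2 * sin y + sin y * (cos y)\<^sup>2 - 3 * y * cos y) \<longlongrightarrow> (0::real)) (at_right 0)"
        by real_asymp
    next
      fix z :: real assume z: "0 < z" "z < pi/2"
      show "((\<lambda>y. 2 * sin y + sin y * (cos y)\<^sup>2 - 3 * y * cos y)
          has_real_derivative 3 * sin z * (z - sin z * cos z)) (at z)"
        by (auto intro!: derivative_eq_intros, use sin_cos_squared_add[of z] in algebra)
      show "3 * sin z * (z - sin z * cos z) > 0"
        using z sin_gt_zero[of z] sin_mult_cos_less[of z] by simp
    qed
    then show "16 * sin y * (2 * sin y + sin y * (cos y)\<^sup>2 - 3 * y * cos y) > 0"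
      using sin_gt_zero[of y] y by simp
  qed
qed

text \<open>Taking arctan makes the Riccati comparison linear: arctan (3p/2 g) starts at 0 and its
  derivative stays below p exactly when g' < 2/3 (1 + (3p/2 g)^2), so it stays below
  \<open>p * t\<close>.\<close>

lemma deriv_one_minus_mult_cot_less_tan:
  fixes p t :: real
  assumes p: "0 < p" "p\<^sup>2 = 2/5" and t: "0 < t" "t < pi/2"
  shows "(t - sin t * cos t) / (sin t)\<^sup>2 < 2 / (3 * p) * tan (p * t)"
proof -
  let ?g = "\<lambda>t. (t - sin t * cos t) / (sin t)\<^sup>2 :: real"
  have "p < 1" using p by (intro power_less_imp_less_base[of p 2 1]) auto
  then have pt: "0 < p * t" "p * t < pi/2"
    using mult_pos_pos[OF p(1) t(1)] mult_strict_right_mono[OF \<open>p < 1\<close> t(1)] t by linarith+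
  have "p * t - arctan (3 * p / 2 * ?g t) > 0"
  proof (rule deriv_pos_imp_pos[OF _ _ _ t])
    have "(?g \<longlongrightarrow> 0) (at_right 0)" by real_asymp
    then have "((\<lambda>t. p * t - arctan (3 * p / 2 * ?g t)) \<longlongrightarrow> p * 0 - arctan (3 * p / 2 * 0)) (at_right 0)"
      by (intro tendsto_intros)
    then show "((\<lambda>t. p * t - arctan (3 * p / 2 * ?g t)) \<longlongrightarrow> 0) (at_right 0)"
      by simp
  next
    fix x :: real assume x: "0 < x" "x < pi/2"
    have s: "sin x > 0" using x by (intro sin_gt_zero) auto
    have g': "(?g has_real_derivative 2 - 2 * ?g x * cos x / sin x) (at x)"
      using s by (auto intro!: derivative_eq_intros simp: divide_simps,
        use sin_cos_squared_add[of x] in algebra)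
    show "((\<lambda>t. p * t - arctan (3 * p / 2 * ?g t)) has_real_derivative
        p - 3 * p / 2 * (2 - 2 * ?g x * cos x / sin x) / (1 + (3 * p / 2 * ?g x)\<^sup>2)) (at x)"
      by (rule DERIV_cong[OF DERIV_diff[OF DERIV_cmult[OF DERIV_ident]
            DERIV_chain2[OF DERIV_arctan DERIV_cmult[OF g']]]])
        (simp only: divide_inverse mult_ac mult_1_right)
    have "(2 - 2 * ?g x * cos x / sin x) * 15 * sin x ^ 4
        = 30 * sin x ^ 4 - 30 * (x - sin x * cos x) * sin x * cos x"
      using s by (simp add: field_simps eval_nat_numeral)
    also have "\<dots> < 10 * sin x ^ 4 + 9 * (x - sin x * cos x)\<^sup>2"
      using riccati_quadratic_pos[OF x] by (simp add: power2_eq_square algebra_simps)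
    also have "\<dots> = (2 / 3 + 3 / 5 * (?g x)\<^sup>2) * 15 * sin x ^ 4"
      using s by (simp add: field_simps eval_nat_numeral)
    finally have "2 - 2 * ?g x * cos x / sin x < 2 / 3 + 3 / 5 * (?g x)\<^sup>2"
      using s by simp
    \<comment> \<open>The coefficients match because 2/3 * 9/4 * p^2 = 3/5 for p^2 = 2/5.\<close>
    also have "\<dots> = 2 / 3 * (1 + (3 * p / 2 * ?g x)\<^sup>2)"
      by (simp add: power_mult_distrib power_divide p(2))
    finally have "3 / 2 * (2 - 2 * ?g x * cos x / sin x) / (1 + (3 * p / 2 * ?g x)\<^sup>2) < 1"
      using sum_power2_gt_zero_iff[of 1 "3 * p / 2 * ?g x"] by (subst pos_divide_less_eq) simp_all
    from mult_strict_left_mono[OF this p(1)]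
    show "0 < p - 3 * p / 2 * (2 - 2 * ?g x * cos x / sin x) / (1 + (3 * p / 2 * ?g x)\<^sup>2)"
      by (simp add: mult_ac)
  qed
  then have "tan (arctan (3 * p / 2 * ?g t)) < tan (p * t)"
    using pt arctan_bounded[of "3 * p / 2 * ?g t"] by (intro tan_monotone) auto
  then have "3 * p / 2 * ?g t < tan (p * t)" by (simp only: tan_arctan)
  then have "?g t < tan (p * t) / (3 * p / 2)"
    using p(1) by (subst pos_less_divide_eq) (simp, subst mult.commute, assumption)
  then show ?thesis by (simp add: mult.commute)
qed

text \<open>Both sides tend to 0 at 0, and the preceding lemma compares their derivatives. The
  expansions start with t^2/3 + t^4/45 and t^2/3 + p^2 t^4/18, so 2/5 is the value of p^2 at which
  the t^4 terms agree.\<close>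

lemma one_minus_mult_cot_less:
  fixes p t :: real
  assumes p: "0 < p" "p\<^sup>2 = 2/5" and t: "0 < t" "t < pi/2"
  shows "1 - t * cot t < 2 / (3 * p\<^sup>2) * (- ln (cos (p * t)))"
proof -
  have "p < 1" using p by (intro power_less_imp_less_base[of p 2 1]) auto
  have "0 < 2 / (3 * p\<^sup>2) * (- ln (cos (p * t))) - (1 - t * cot t)"
  proof (rule deriv_pos_imp_pos[OF _ _ _ t])
    show "((\<lambda>t. 2 / (3 * p\<^sup>2) * (- ln (cos (p * t))) - (1 - t * cot t)) \<longlongrightarrow> 0) (at_right 0)"
      using p(1) unfolding cot_def by real_asymp
  next
    fix x :: real assume x: "0 < x" "x < pi/2"
    have s: "sin x \<noteq> 0" using x sin_gt_zero[of x] by simp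
    have c: "cos (p * x) > 0"
      using p x mult_strict_right_mono[OF \<open>p < 1\<close> x(1)] by (intro cos_gt_zero) (simp, linarith)
    show "((\<lambda>t. 2 / (3 * p\<^sup>2) * (- ln (cos (p * t))) - (1 - t * cot t)) has_real_derivative
        2 / (3 * p) * tan (p * x) - (x - sin x * cos x) / (sin x)\<^sup>2) (at x)"
      by (rule derivative_eq_intros has_real_derivative_one_minus_mult_cot s c refl)+
        (use p c in \<open>simp add: tan_def field_simps power2_eq_square\<close>)
    show "2 / (3 * p) * tan (p * x) - (x - sin x * cos x) / (sin x)\<^sup>2 > 0"
      using deriv_one_minus_mult_cot_less_tan[OF p x] by simp
  qed
  then show ?thesis by simp
qed

section \<open>Exponential form of the bounds and the best exponents\<close>

lemma cos_powr_less_exp_cot: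
  fixes p t :: real
  assumes "sqrt 10 / 5 \<le> p" "p \<le> 1" "0 < t" "t < pi/2"
  shows "cos (p * t) powr (2 / (3 * p\<^sup>2)) < exp (t * cot t - 1)"
proof -
  \<comment> \<open>The left end of the range of \<open>p\<close> has square 2/5 and is the worst
    case, because the power of the cosine decreases in \<open>p\<close>.\<close>
  define p0 :: real where "p0 = sqrt 10 / 5"
  have p0: "0 < p0" "p0\<^sup>2 = 2/5" by (auto simp: p0_def power_divide)
  have pt: "p * t < pi/2" using mult_right_mono[of p 1 t] assms by linarith
  have "cos (p * t) powr (2 / (3 * p\<^sup>2)) \<le> cos (p0 * t) powr (2 / (3 * p0\<^sup>2))"
  proof (cases "p = p0")
    case True
    show ?thesis unfolding True by simp
  next
    case False
    then show ?thesis
      using assms pt p0(1) by (intro cos_powr_antimono[THEN less_imp_le]) (auto simp: p0_def)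
  qed
  also have "p0 * t < pi/2"
    using mult_right_mono[of p0 p t] assms pt unfolding p0_def by linarith
  then have "cos (p0 * t) > 0" using p0 assms by (intro cos_gt_zero) auto
  then have "cos (p0 * t) powr (2 / (3 * p0\<^sup>2)) < exp (t * cot t - 1)"
    using one_minus_mult_cot_less[OF p0 assms(3,4)] by (simp add: powr_def)
  finally show ?thesis .
qed

lemma exp_cot_bounds_cos_half:
  fixes t :: real
  assumes "0 < t" "t < pi/2"
  shows "exp (t * cot t - 1) < cos (t / 2) powr (8 / 3)"
    and "cos (t / 2) powr (2 / ln 2) < exp (t * cot t - 1)"
proof -
  have "cos (t / 2) > 0" using assms by (intro cos_gt_zero) auto
  then show "exp (t * cot t - 1) < cos (t / 2) powr (8 / 3)"
    "cos (t / 2) powr (2 / ln 2) < exp (t * cot t - 1)"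
    using one_minus_mult_cot_bounds[OF assms] by (simp_all add: powr_def)
qed

lemma exp_cot_less_cos_powr:
  fixes q t :: real
  assumes "0 < q" "q \<le> 1/2" "0 < t" "t < pi/2"
  shows "exp (t * cot t - 1) < cos (q * t) powr (2 / (3 * q\<^sup>2))"
proof -
  \<comment> \<open>The exponent 8/3 is 2 / (3 q^2) at the extreme value q = 1/2.\<close>
  have "exp (t * cot t - 1) < cos (1/2 * t) powr (2 / (3 * (1/2)\<^sup>2))"
    using exp_cot_bounds_cos_half(1)[OF assms(3,4)] by (simp add: power2_eq_square)
  also have "\<dots> \<le> cos (q * t) powr (2 / (3 * q\<^sup>2))"
  proof (cases "q = 1/2")
    case True
    show ?thesis unfolding True by simp
  next
    case False
    then show ?thesis using assms by (intro cos_powr_antimono[THEN less_imp_le]) auto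
  qed
  finally show ?thesis .
qed

text \<open>As t tends to pi/2 the hypothesis becomes (sqrt 2 / 2)^r \<le> 1/e, and ln (sqrt 2 / 2)
  = - ln 2 / 2.\<close>

lemma cos_half_exponent_lower:
  fixes r :: real
  assumes "\<forall>t \<in> {0<..<pi/2}. cos (t / 2) powr r < exp (t * cot t - 1)"
  shows "r \<ge> 2 / ln 2"
proof -
  have ev: "eventually (\<lambda>t. cos (t / 2) powr r \<le> exp (t * cot t - 1)) (at_left (pi/2))"
    using eventually_at_left_real[of 0 "pi/2"] assms
    by (auto elim!: eventually_mono simp: less_imp_le)
  have "((\<lambda>t. cos (t / 2) powr r) \<longlongrightarrow> cos (pi / 2 / 2) powr r) (at_left (pi/2))"
    by (intro tendsto_intros) (simp_all add: cos_45)
  moreover have "((\<lambda>t. exp (t * cot t - 1)) \<longlongrightarrow> exp (pi / 2 * cot (pi/2) - 1)) (at_left (pi/2))"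
    unfolding cot_def by (intro tendsto_intros) simp_all
  ultimately have "cos (pi / 2 / 2) powr r \<le> exp (pi / 2 * cot (pi/2) - 1)"
    by (intro tendsto_le[OF _ _ _ ev]) auto
  then have "(sqrt 2 / 2) powr r \<le> exp (-1)" by (simp add: cos_45 cot_def)
  then have "r * ln (sqrt 2 / 2) \<le> -1" by (simp add: powr_def)
  then show ?thesis by (simp add: ln_div ln_sqrt field_simps)
qed

text \<open>After logarithms the hypothesis bounds \<open>s\<close> by the ratio of 1 - t cot t to -
  ln (cos (t / 2)), whose limit at 0 is 8/3.\<close>

lemma cos_half_exponent_upper:
  fixes s :: real
  assumes "\<forall>t \<in> {0<..<pi/2}. exp (t * cot t - 1) < cos (t / 2) powr s"
  shows "s \<le> 8 / 3"
proof (rule tendsto_lowerbound[OF one_minus_mult_cot_div_tendsto])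
  show "eventually (\<lambda>t. s \<le> (1 - t * cot t) / (- ln (cos (t / 2)))) (at_right 0)"
    using eventually_at_right_real[OF pi_half_gt_zero]
  proof eventually_elim
    case (elim t)
    have "0 < - ln (cos (t / 2))"
      using ln_cos_neg[of "t/2"] elim by simp
    moreover have "cos (t / 2) > 0" using elim by (intro cos_gt_zero) auto
    then have "t * cot t - 1 < s * ln (cos (t / 2))"
      using assms[rule_format, of t] elim by (simp add: powr_def)
    ultimately show ?case by (simp add: field_simps)
  qed
qed simp

theorem theorem2:
  shows
    "(\<forall>p q :: real. p \<in> {sqrt 10 / 5 .. 1} \<longrightarrow> q \<in> {0 <.. 1 / 2} \<longrightarrow>
       (\<forall>t \<in> {0 <..< pi / 2}.
          cos (p * t) powr (2 / (3 * p\<^sup>2)) < exp (t * cot t - 1) \<and>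
          exp (t * cot t - 1) < cos (q * t) powr (2 / (3 * q\<^sup>2))))
     \<and>
     (\<forall>t \<in> {0 <..< pi / 2 :: real}.
       cos (2 * t / 3) powr (3 / 2) < exp (t * cot t - 1) \<and>
       exp (t * cot t - 1) < cos (t / 2) powr (8 / 3) \<and>
       cos (t / 2) powr (8 / 3) < cos (t / 3) ^ 6 \<and>
       cos (t / 3) ^ 6 < exp (- (t\<^sup>2 / 3)))
     \<and>
     (\<forall>t \<in> {0 <..< pi / 2 :: real}.
        cos (t / 2) powr (2 / ln 2) < exp (t * cot t - 1) \<and>
        exp (t * cot t - 1) < cos (t / 2) powr (8 / 3))
     \<and>
     (\<forall>r :: real. (\<forall>t \<in> {0 <..< pi / 2}. cos (t / 2) powr r < exp (t * cot t - 1))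
        \<longrightarrow> r \<ge> 2 / ln 2)
     \<and>
     (\<forall>s :: real. (\<forall>t \<in> {0 <..< pi / 2}. exp (t * cot t - 1) < cos (t / 2) powr s)
        \<longrightarrow> s \<le> 8 / 3)"
proof (intro conjI allI impI ballI)
  fix t :: real assume t: "t \<in> {0<..<pi/2}"
  have c3: "cos (t / 3) > 0" using t by (intro cos_gt_zero) auto
  \<comment> \<open>This makes p = 2/3 admissible in (a); its exponent 2 / (3 p^2) is 3/2.\<close>
  have "sqrt 10 \<le> sqrt ((10/3)\<^sup>2)" by (intro real_sqrt_le_mono) (simp add: power2_eq_square)
  then have "sqrt 10 / 5 \<le> 2 / (3::real)" by simp
  from cos_powr_less_exp_cot[OF this] t
  show "cos (2 * t / 3) powr (3 / 2) < exp (t * cot t - 1)"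
    by (simp add: power2_eq_square)
  \<comment> \<open>The parameters 1/2 and 1/3 have exponents 8/3 and 6.\<close>
  have "cos (1/2 * t) powr (2 / (3 * (1/2)\<^sup>2)) < cos (1/3 * t) powr (2 / (3 * (1/3)\<^sup>2))"
    using t by (intro cos_powr_antimono) auto
  then show "cos (t / 2) powr (8 / 3) < cos (t / 3) ^ 6"
    using c3 by (simp add: power2_eq_square powr_numeral)
  have "cos (t / 3) ^ 6 = exp (6 * ln (cos (t / 3)))"
    using c3 by (simp add: powr_numeral[symmetric] powr_def)
  \<comment> \<open>Six times the bound ln (cos (t/3)) < - t^2/18.\<close>
  also have "\<dots> < exp (- (t\<^sup>2 / 3))"
    using ln_cos_less[of "t/3"] t by (simp add: power_divide)
  finally show "cos (t / 3) ^ 6 < exp (- (t\<^sup>2 / 3))" .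
qed (use cos_powr_less_exp_cot exp_cot_less_cos_powr exp_cot_bounds_cos_half
      cos_half_exponent_lower cos_half_exponent_upper in auto)

end
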